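(* Assume the Unique Games Conjecture and $\mathrm{P}\ne\mathrm{NP}$. Then for every $k\ge2$ and every $\epsilon>0$ there is no polynomial-time $\left(2-\frac2k-\epsilon\right)$-approximation algorithm for the submodular multi-labeling (Sub-ML) problem with $k$ labels.
   Context: **Sub-ML problem.** Given a finite ground set $V$, a non-negative submodular set function $f:2^V\to\mathbb{R}$ (i.e. $f(X)+f(Y)\ge f(X\cap Y)+f(X\cup Y)$ for all $X,Y\subseteq V$) with $f(\emptyset)=0$, accessed through a value oracle, a label set $L=\{1,\dots,k\}$, and a partial labeling function pre-assigning each label $i$ to a non-empty subset $T_i\subset V$ (the $T_i$ pairwise disjoint), find a partition $\{S_1,\dots,S_k\}$ of $V$ with $T_i\subseteq S_i$ for all $i$ minimizing $\sum_{i=1}^k f(S_i)$. A $\rho$-approximation algorithm for a minimization problem outputs, on every instance, a feasible solution of value at most $\rho$ times the optimum. **Unique Games Conjecture** (Khot): for every $\delta>0$ there is an alphabet size $R$ such that, for Unique Games instances (constraint graphs whose edge constraints are bijections of an alphabet of size $R$), it is NP-hard to distinguish instances in which some assignment satisfies at least a $1-\delta$ fraction of the constraints from those in which no assignment satisfies more than a $\delta$ fraction. *)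

theory Defs
  imports
    Complex_Main
    "HOL-Computational_Algebra.Polynomial"
    "HOL-Library.Disjoint_Sets"
begin

section \<open>Oracle Turing machines\<close>

text \<open>
  Deterministic multi-tape machines with two-way infinite tapes. Tape 0 holds the input,
  tape 1 is the oracle tape, tape 2 holds the output; the remaining ones are work tapes.
  Words occupy the cells 0, 1, 2, ... of a tape, up to the first cell that is not a bit.
\<close>

datatype symbol = Blank | Bit bool | Aux nat

datatype move = MoveLeft | NoMove | MoveRight

type_synonym tape = "(int \<Rightarrow> symbol) \<times> int"  \<comment> \<open>cell contents and head position\<close>

type_synonym config = "nat \<times> tape list"

record otm =
  num_states :: nat
  num_aux :: nat
  num_tapes :: nat
  trans :: "nat \<Rightarrow> symbol list \<Rightarrow> nat \<times> (symbol \<times> move) list"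

definition start_state :: nat where "start_state = 0"
definition halt_state :: nat where "halt_state = 1"
definition query_state :: nat where "query_state = 2"
definition answer_state :: nat where "answer_state = 3"

definition alphabet :: "otm \<Rightarrow> symbol set" where
  "alphabet M = {Blank} \<union> range Bit \<union> Aux ` {..<num_aux M}"

definition wf_otm :: "otm \<Rightarrow> bool" where
  "wf_otm M \<longleftrightarrow> num_states M \<ge> 4 \<and> num_tapes M \<ge> 3 \<and>
     (\<forall>q as. q < num_states M \<and> length as = num_tapes M \<and> set as \<subseteq> alphabet M \<longrightarrow>
        (case trans M q as of (q', acts) \<Rightarrow>
           q' < num_states M \<and> length acts = num_tapes M \<and> fst ` set acts \<subseteq> alphabet M))"

definition write_word :: "bool list \<Rightarrow> tape" where
  "write_word w = (\<lambda>i. if 0 \<le> i \<and> i < int (length w) then Bit (w ! nat i) else Blank, 0)"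

definition read_word :: "tape \<Rightarrow> bool list" where
  "read_word t =
     map (\<lambda>j. fst t (int j) = Bit True) [0..<(LEAST j. fst t (int j) \<notin> range Bit)]"

fun shift :: "move \<Rightarrow> int" where
  "shift MoveLeft = - 1"
| "shift NoMove = 0"
| "shift MoveRight = 1"

fun act :: "symbol \<times> move \<Rightarrow> tape \<Rightarrow> tape" where
  "act (a, m) (c, h) = (c(h := a), h + shift m)"

text \<open>
  In the query state, the word on the oracle tape is replaced by the answer of the oracle
  in a single step. The halting state is a fixed point of the step function.
\<close>

fun step :: "otm \<Rightarrow> (bool list \<Rightarrow> bool list) \<Rightarrow> config \<Rightarrow> config" where
  "step M orc (q, ts) =
     (if q = halt_state then (q, ts)
      else if q = query_state then
        (answer_state, ts[1 := write_word (orc (read_word (ts ! 1)))])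
      else case trans M q (map (\<lambda>(c, h). c h) ts) of (q', acts) \<Rightarrow> (q', map2 act acts ts))"

definition init_config :: "otm \<Rightarrow> bool list \<Rightarrow> config" where
  "init_config M w =
     (start_state, write_word w # replicate (num_tapes M - 1) (write_word []))"

definition computes_within ::
  "otm \<Rightarrow> (bool list \<Rightarrow> bool list) \<Rightarrow> bool list \<Rightarrow> nat \<Rightarrow> bool list \<Rightarrow> bool" where
  "computes_within M orc w t out \<longleftrightarrow>
     (case (step M orc ^^ t) (init_config M w) of (q, ts) \<Rightarrow>
        q = halt_state \<and> read_word (ts ! 2) = out)"


section \<open>P, NP and NP-hardness of promise problems\<close>

text \<open>Machines without an oracle are those run with the constant oracle.\<close>

definition poly_time_computable :: "(bool list \<Rightarrow> bool list) \<Rightarrow> bool" where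
  "poly_time_computable g \<longleftrightarrow>
     (\<exists>M (p :: nat poly). wf_otm M \<and>
        (\<forall>w. computes_within M (\<lambda>_. []) w (poly p (length w)) (g w)))"

definition class_P :: "bool list set set" where
  "class_P = {L. poly_time_computable (\<lambda>w. [w \<in> L])}"

text \<open>A prefix-free encoding of words.\<close>

definition enc_word :: "bool list \<Rightarrow> bool list" where
  "enc_word w = concat (map (\<lambda>b. [True, b]) w) @ [False]"

definition class_NP :: "bool list set set" where
  "class_NP = {L. \<exists>V \<in> class_P. \<exists>q :: nat poly. \<forall>w.
     w \<in> L \<longleftrightarrow> (\<exists>c. length c \<le> poly q (length w) \<and> enc_word w @ c \<in> V)}"

text \<open>Hardness under many-one reductions of distinguishing \<open>Yes\<close> from \<open>No\<close>.\<close>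

definition np_hard_to_distinguish :: "bool list set \<Rightarrow> bool list set \<Rightarrow> bool" where
  "np_hard_to_distinguish Yes No \<longleftrightarrow>
     (\<forall>L \<in> class_NP. \<exists>g. poly_time_computable g \<and>
        (\<forall>w. (w \<in> L \<longrightarrow> g w \<in> Yes) \<and> (w \<notin> L \<longrightarrow> g w \<in> No)))"

text \<open>Binary representation, least significant bit first.\<close>

fun nat_bits :: "nat \<Rightarrow> bool list" where
  "nat_bits n = (if n = 0 then [] else odd n # nat_bits (n div 2))"

declare nat_bits.simps [simp del]

definition enc_nat :: "nat \<Rightarrow> bool list" where
  "enc_nat n = enc_word (nat_bits n)"


section \<open>The Unique Games Conjecture\<close>

text \<open>
  A constraint \<open>(u, v, \<pi>)\<close> sits on the edge \<open>{u, v}\<close> of a simple graph with vertices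
  \<open>{..<ug_vertices U}\<close>; an assignment \<open>\<sigma>\<close> satisfies it if \<open>\<pi> (\<sigma> u) = \<sigma> v\<close>. Listing every
  edge with \<open>u < v\<close> is no restriction, as the opposite orientation carries the inverse of \<open>\<pi>\<close>.
\<close>

record unique_game =
  ug_vertices :: nat
  ug_constraints :: "(nat \<times> nat \<times> (nat \<Rightarrow> nat)) list"

definition unique_game_instance :: "nat \<Rightarrow> unique_game \<Rightarrow> bool" where
  "unique_game_instance R U \<longleftrightarrow>
     ug_constraints U \<noteq> [] \<and>
     distinct (map (\<lambda>(u, v, \<pi>). (u, v)) (ug_constraints U)) \<and>
     (\<forall>(u, v, \<pi>) \<in> set (ug_constraints U).
        u < v \<and> v < ug_vertices U \<and> bij_betw \<pi> {..<R} {..<R})"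

definition ug_assignments :: "nat \<Rightarrow> unique_game \<Rightarrow> (nat \<Rightarrow> nat) set" where
  "ug_assignments R U = {\<sigma>. \<forall>v < ug_vertices U. \<sigma> v < R}"

definition ug_fraction :: "unique_game \<Rightarrow> (nat \<Rightarrow> nat) \<Rightarrow> real" where
  "ug_fraction U \<sigma> =
     real (length (filter (\<lambda>(u, v, \<pi>). \<pi> (\<sigma> u) = \<sigma> v) (ug_constraints U)))
       / real (length (ug_constraints U))"

definition enc_unique_game :: "nat \<Rightarrow> unique_game \<Rightarrow> bool list" where
  "enc_unique_game R U =
     enc_nat (ug_vertices U) @ enc_nat (length (ug_constraints U)) @
     concat (map (\<lambda>(u, v, \<pi>). enc_nat u @ enc_nat v @ concat (map (\<lambda>a. enc_nat (\<pi> a)) [0..<R]))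
       (ug_constraints U))"

definition unique_games_conjecture :: bool where
  "unique_games_conjecture \<longleftrightarrow>
     (\<forall>\<delta> :: real. \<delta> > 0 \<longrightarrow> (\<exists>R.
        np_hard_to_distinguish
          {enc_unique_game R U | U. unique_game_instance R U \<and>
             (\<exists>\<sigma> \<in> ug_assignments R U. ug_fraction U \<sigma> \<ge> 1 - \<delta>)}
          {enc_unique_game R U | U. unique_game_instance R U \<and>
             (\<forall>\<sigma> \<in> ug_assignments R U. ug_fraction U \<sigma> \<le> \<delta>)}))"


section \<open>Submodular multi-labeling\<close>

definition submodular_on :: "'a set \<Rightarrow> ('a set \<Rightarrow> real) \<Rightarrow> bool" where
  "submodular_on V f \<longleftrightarrow>
     (\<forall>X Y. X \<subseteq> V \<and> Y \<subseteq> V \<longrightarrow> f X + f Y \<ge> f (X \<inter> Y) + f (X \<union> Y))"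

definition sub_ml_instance ::
  "nat \<Rightarrow> 'a set \<Rightarrow> ('a set \<Rightarrow> real) \<Rightarrow> (nat \<Rightarrow> 'a set) \<Rightarrow> bool" where
  "sub_ml_instance k V f T \<longleftrightarrow>
     finite V \<and> submodular_on V f \<and> (\<forall>X \<subseteq> V. f X \<ge> 0) \<and> f {} = 0 \<and>
     (\<forall>i \<in> {1..k}. T i \<noteq> {} \<and> T i \<subseteq> V) \<and> disjoint_family_on T {1..k}"

definition sub_ml_feasible ::
  "nat \<Rightarrow> 'a set \<Rightarrow> (nat \<Rightarrow> 'a set) \<Rightarrow> (nat \<Rightarrow> 'a set) \<Rightarrow> bool" where
  "sub_ml_feasible k V T S \<longleftrightarrow>
     disjoint_family_on S {1..k} \<and> (\<Union>i \<in> {1..k}. S i) = V \<and> (\<forall>i \<in> {1..k}. T i \<subseteq> S i)"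

definition sub_ml_cost :: "nat \<Rightarrow> ('a set \<Rightarrow> real) \<Rightarrow> (nat \<Rightarrow> 'a set) \<Rightarrow> real" where
  "sub_ml_cost k f S = (\<Sum>i = 1..k. f (S i))"

definition sub_ml_opt ::
  "nat \<Rightarrow> 'a set \<Rightarrow> ('a set \<Rightarrow> real) \<Rightarrow> (nat \<Rightarrow> 'a set) \<Rightarrow> real" where
  "sub_ml_opt k V f T = Min {sub_ml_cost k f S | S. sub_ml_feasible k V T S}"


section \<open>Approximation algorithms in the value oracle model\<close>

text \<open>Characteristic vectors of \<open>S 1, ..., S k\<close> on the ground set \<open>{..<n}\<close>.\<close>

definition enc_family :: "nat \<Rightarrow> nat \<Rightarrow> (nat \<Rightarrow> nat set) \<Rightarrow> bool list" where
  "enc_family k n S = concat (map (\<lambda>i. map (\<lambda>v. v \<in> S i) [0..<n]) [1..<Suc k])"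

definition enc_instance :: "nat \<Rightarrow> nat \<Rightarrow> (nat \<Rightarrow> nat set) \<Rightarrow> bool list" where
  "enc_instance k n T = enc_nat n @ enc_family k n T"

text \<open>Only used for non-negative numbers.\<close>

definition enc_rat :: "rat \<Rightarrow> bool list" where
  "enc_rat r = (case quotient_of r of (a, b) \<Rightarrow> enc_nat (nat a) @ enc_nat (nat b))"

text \<open>
  A Turing machine can only read values with a finite representation, so the value oracle
  serves rational-valued functions. A query is the characteristic vector of a subset of
  \<open>{..<n}\<close>; the function itself is accessible through the oracle only.
\<close>

definition value_oracle :: "nat \<Rightarrow> (nat set \<Rightarrow> rat) \<Rightarrow> bool list \<Rightarrow> bool list" where
  "value_oracle n g w = (if length w = n then enc_rat (g {v. v < n \<and> w ! v}) else [])"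

definition value_size :: "nat \<Rightarrow> (nat set \<Rightarrow> rat) \<Rightarrow> nat" where
  "value_size n g = Max ((\<lambda>X. length (enc_rat (g X))) ` Pow {..<n})"

text \<open>
  As usual in the oracle model, the running time is polynomial in the length of the explicit
  part of the input and the maximal encoding length of a function value.
\<close>

definition sub_ml_approximation :: "nat \<Rightarrow> real \<Rightarrow> otm \<Rightarrow> bool" where
  "sub_ml_approximation k \<rho> M \<longleftrightarrow>
     (\<exists>p :: nat poly. \<forall>n g T.
        sub_ml_instance k {..<n} (\<lambda>X. real_of_rat (g X)) T \<longrightarrow>
        (\<exists>S. computes_within M (value_oracle n g) (enc_instance k n T)
               (poly p (length (enc_instance k n T) + value_size n g)) (enc_family k n S) \<and>
             sub_ml_feasible k {..<n} T S \<and>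
             sub_ml_cost k (\<lambda>X. real_of_rat (g X)) S
               \<le> \<rho> * sub_ml_opt k {..<n} (\<lambda>X. real_of_rat (g X)) T))"

end

theory Submission
  imports Defs
begin

text \<open>
  The adversary's instances live on a multigraph whose vertices are the labels and whose edges
  form the ground set. A public cost charges label \<open>i\<close>, once it holds its terminal, for the
  incident edges it misses, truncated at \<open>2 w\<close>. Since any two labels compete for their many
  common edges, at most one label is charged less than \<open>2 w\<close>, so every solution costs at least
  \<open>2 w (k - 1)\<close>. A hidden orientation of the edges allows for a second cost, in which the missed
  incoming and the missed outgoing edges at \<open>i\<close> are first truncated separately at \<open>w + d\<close>; giving
  every edge to its head then costs at most \<open>k (w + d)\<close>. On a set whose complement contains almost
  as many incoming as outgoing edges at each label the two costs coincide, and a Chernoff bound shows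
  that a fixed set violates this only for an exponentially small fraction of the orientations. Hence
  some orientation is consistent with all queries and the output of a polynomial-time run on the
  public cost, and on its hidden cost the machine returns the same solution. The ratio tends to
  \<open>2 (k - 1) / k\<close> as \<open>d / w\<close> tends to \<open>0\<close>.
\<close>

section \<open>Polymatroids\<close>

definition polymatroid :: "('a set \<Rightarrow> nat) \<Rightarrow> bool" where
  "polymatroid r \<longleftrightarrow> (\<forall>X Y. finite Y \<longrightarrow> X \<subseteq> Y \<longrightarrow> r X \<le> r Y) \<and>
     (\<forall>X Y. finite X \<longrightarrow> finite Y \<longrightarrow> r (X \<inter> Y) + r (X \<union> Y) \<le> r X + r Y)"

lemma polymatroid_card_Int: "polymatroid (\<lambda>X. card (X \<inter> A))"
  unfolding polymatroid_def
proof (intro conjI allI impI)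
  fix X Y :: "'a set"
  assume "finite Y" "X \<subseteq> Y"
  then show "card (X \<inter> A) \<le> card (Y \<inter> A)"
    by (intro card_mono) auto
next
  fix X Y :: "'a set"
  assume "finite X" "finite Y"
  then have "card (X \<inter> A) + card (Y \<inter> A) =
      card ((X \<inter> A) \<union> (Y \<inter> A)) + card ((X \<inter> A) \<inter> (Y \<inter> A))"
    by (intro card_Un_Int) auto
  moreover have "(X \<inter> A) \<union> (Y \<inter> A) = (X \<union> Y) \<inter> A" "(X \<inter> A) \<inter> (Y \<inter> A) = X \<inter> Y \<inter> A"
    by auto
  ultimately show "card (X \<inter> Y \<inter> A) + card ((X \<union> Y) \<inter> A) \<le> card (X \<inter> A) + card (Y \<inter> A)"
    by simp
qed

lemma polymatroid_add:
  assumes "polymatroid r" "polymatroid s"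
  shows "polymatroid (\<lambda>X. r X + s X)"
  unfolding polymatroid_def
proof (intro conjI allI impI)
  fix X Y :: "'a set"
  assume "finite Y" "X \<subseteq> Y"
  then show "r X + s X \<le> r Y + s Y"
    using assms by (intro add_mono) (auto simp: polymatroid_def)
next
  fix X Y :: "'a set"
  assume "finite X" "finite Y"
  then have "r (X \<inter> Y) + r (X \<union> Y) \<le> r X + r Y" "s (X \<inter> Y) + s (X \<union> Y) \<le> s X + s Y"
    using assms by (auto simp: polymatroid_def)
  then show "r (X \<inter> Y) + s (X \<inter> Y) + (r (X \<union> Y) + s (X \<union> Y)) \<le> r X + s X + (r Y + s Y)"
    by linarith
qed

text \<open>If one of \<open>r X\<close>, \<open>r Y\<close> reaches \<open>c\<close>, so does
  \<open>r (X \<union> Y)\<close> by monotonicity, and it remains to compare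
  \<open>X \<inter> Y\<close> with the other set. If both stay below \<open>c\<close>, the
  right-hand side is not truncated at all.\<close>

lemma polymatroid_min:
  assumes "polymatroid r"
  shows "polymatroid (\<lambda>X. min c (r X))"
  unfolding polymatroid_def
proof (intro conjI allI impI)
  fix X Y :: "'a set"
  assume "finite Y" "X \<subseteq> Y"
  then show "min c (r X) \<le> min c (r Y)"
    using assms by (intro min.mono) (auto simp: polymatroid_def)
next
  fix X Y :: "'a set"
  assume fin: "finite X" "finite Y"
  then have "r (X \<inter> Y) + r (X \<union> Y) \<le> r X + r Y" "r (X \<inter> Y) \<le> r X" "r (X \<inter> Y) \<le> r Y"
    "r X \<le> r (X \<union> Y)" "r Y \<le> r (X \<union> Y)"
    using assms by (auto simp: polymatroid_def)
  then show "min c (r (X \<inter> Y)) + min c (r (X \<union> Y)) \<le> min c (r X) + min c (r Y)"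
    by linarith
qed

text \<open>The terminal \<open>t i\<close> acts as a gate: label \<open>i\<close> is charged for
  what \<open>S\<close> misses only if \<open>S\<close> holds its terminal. This gives the empty set
  cost 0.\<close>

definition gated_cost :: "nat \<Rightarrow> 'a set \<Rightarrow> (nat \<Rightarrow> 'a) \<Rightarrow> (nat \<Rightarrow> 'a set \<Rightarrow> nat) \<Rightarrow> 'a set \<Rightarrow> nat" where
  "gated_cost k V t r S = (\<Sum>i = 1..k. if t i \<in> S then r i (V - S) else 0)"

text \<open>Complementation swaps unions and intersections. If both sets hold \<open>t i\<close>,
  submodularity of \<open>r i\<close> applies. If only one does, the gate of the intersection is
  closed and monotonicity suffices.\<close>

lemma submodular_on_gated_cost:
  assumes "finite V" and r: "\<And>i. i \<in> {1..k} \<Longrightarrow> polymatroid (r i)"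
  shows "submodular_on V (\<lambda>S. real (gated_cost k V t r S))"
  unfolding submodular_on_def
proof (intro allI impI)
  fix X Y
  let ?g = "\<lambda>i S. if t i \<in> S then r i (V - S) else 0"
  have "?g i (X \<inter> Y) + ?g i (X \<union> Y) \<le> ?g i X + ?g i Y" if i: "i \<in> {1..k}" for i
  proof -
    have "V - X \<inter> Y = (V - X) \<union> (V - Y)" "V - (X \<union> Y) = (V - X) \<inter> (V - Y)"
      by auto
    moreover have "r i ((V - X) \<inter> (V - Y)) + r i ((V - X) \<union> (V - Y)) \<le> r i (V - X) + r i (V - Y)"
      "r i ((V - X) \<inter> (V - Y)) \<le> r i (V - X)" "r i ((V - X) \<inter> (V - Y)) \<le> r i (V - Y)"
      using r[OF i] \<open>finite V\<close> unfolding polymatroid_def by auto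
    ultimately show ?thesis
      by auto
  qed
  then have "gated_cost k V t r (X \<inter> Y) + gated_cost k V t r (X \<union> Y)
      \<le> gated_cost k V t r X + gated_cost k V t r Y"
    unfolding gated_cost_def sum.distrib[symmetric] by (intro sum_mono)
  then show "real (gated_cost k V t r (X \<inter> Y)) + real (gated_cost k V t r (X \<union> Y))
      \<le> real (gated_cost k V t r X) + real (gated_cost k V t r Y)"
    by linarith
qed


section \<open>The gap instances\<close>

text \<open>
  Elements of the ground set are the edges of a multigraph on the labels, with loops; a set \<open>B\<close>
  orients every edge \<open>v\<close> towards \<open>owner k B v\<close>. The loops at \<open>i\<close> are pre-assigned to label \<open>i\<close>.
\<close>

definition left :: "nat \<Rightarrow> nat \<Rightarrow> nat" where "left k v = Suc (v mod k)"

definition right :: "nat \<Rightarrow> nat \<Rightarrow> nat" where "right k v = Suc (v div k mod k)"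

definition owner :: "nat \<Rightarrow> nat set \<Rightarrow> nat \<Rightarrow> nat" where
  "owner k B v = (if v \<in> B then left k v else right k v)"

definition in_edges :: "nat \<Rightarrow> nat set \<Rightarrow> nat \<Rightarrow> nat set" where
  "in_edges k B i = {v. left k v \<noteq> right k v \<and> owner k B v = i}"

text \<open>Complementing \<open>B\<close> reverses every edge.\<close>

definition out_edges :: "nat \<Rightarrow> nat set \<Rightarrow> nat \<Rightarrow> nat set" where
  "out_edges k B i = in_edges k (- B) i"

definition inc_edges :: "nat \<Rightarrow> nat \<Rightarrow> nat set" where
  "inc_edges k i = {v. left k v \<noteq> right k v \<and> (left k v = i \<or> right k v = i)}"

definition loops :: "nat \<Rightarrow> nat \<Rightarrow> nat \<Rightarrow> nat set" where
  "loops k n i = {v. v < n \<and> left k v = i \<and> right k v = i}"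

text \<open>The first loop at \<open>i\<close>: both lowest base-\<open>k\<close> digits are
  \<open>i - 1\<close> and the remaining ones vanish. It serves as the terminal in the gate of label
  \<open>i\<close>.\<close>

definition loop :: "nat \<Rightarrow> nat \<Rightarrow> nat" where "loop k i = (i - 1) * k + (i - 1)"

definition public_cost :: "nat \<Rightarrow> nat \<Rightarrow> nat \<Rightarrow> nat set \<Rightarrow> nat" where
  "public_cost k n w =
     gated_cost k {..<n} (loop k) (\<lambda>i X. min (2 * w) (card (X \<inter> inc_edges k i)))"

definition hidden_cost :: "nat \<Rightarrow> nat \<Rightarrow> nat \<Rightarrow> nat \<Rightarrow> nat set \<Rightarrow> nat set \<Rightarrow> nat" where
  "hidden_cost k n w d B =
     gated_cost k {..<n} (loop k) (\<lambda>i X. min (2 * w)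
       (min (w + d) (card (X \<inter> in_edges k B i)) + min (w + d) (card (X \<inter> out_edges k B i))))"

section \<open>Edges as numbers in base \<open>k\<close>\<close>

lemma left_digits: "a < k \<Longrightarrow> left k (x * k + a) = Suc a"
  by (simp add: left_def)

lemma right_digits: "a < k \<Longrightarrow> b < k \<Longrightarrow> right k ((x * k + b) * k + a) = Suc b"
  by (simp add: right_def)

lemma left_loop: "1 \<le> i \<Longrightarrow> i \<le> k \<Longrightarrow> left k (loop k i) = i"
  unfolding loop_def by (subst left_digits) auto

lemma right_loop: "1 \<le> i \<Longrightarrow> i \<le> k \<Longrightarrow> right k (loop k i) = i"
  unfolding loop_def using right_digits[of "i - 1" k "i - 1" 0] by auto

lemma loop_less:
  assumes "1 \<le> i" "i \<le> k" "m > 0"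
  shows "loop k i < k * k * m"
proof -
  have "loop k i < (i - 1) * k + k"
    using assms by (simp add: loop_def)
  also have "\<dots> = i * k"
    using assms by (cases i) auto
  also have "\<dots> \<le> k * k * m"
    using assms by (cases m) (auto intro: trans_le_add1)
  finally show ?thesis .
qed

section \<open>Both costs give Sub-ML instances\<close>

lemma sub_ml_instance_gated_cost:
  assumes "m > 0" "n = k * k * m" and "\<And>i. i \<in> {1..k} \<Longrightarrow> polymatroid (r i)"
  shows "sub_ml_instance k {..<n} (\<lambda>S. real (gated_cost k {..<n} (loop k) r S)) (loops k n)"
proof -
  have "loop k i \<in> loops k n i" if "i \<in> {1..k}" for i
    using that assms loop_less[of i k m] left_loop[of i k] right_loop[of i k]
    by (auto simp: loops_def)
  moreover have "submodular_on {..<n} (\<lambda>S. real (gated_cost k {..<n} (loop k) r S))"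
    by (rule submodular_on_gated_cost) (use assms in auto)
  moreover have "gated_cost k {..<n} (loop k) r {} = 0"
    by (simp add: gated_cost_def)
  moreover have "disjoint_family_on (loops k n) {1..k}"
    by (auto simp: disjoint_family_on_def loops_def)
  ultimately show ?thesis
    unfolding sub_ml_instance_def by (fastforce simp: loops_def)
qed

lemma sub_ml_instance_public_cost:
  assumes "m > 0" "n = k * k * m"
  shows "sub_ml_instance k {..<n} (\<lambda>S. real (public_cost k n w S)) (loops k n)"
  unfolding public_cost_def
  by (intro sub_ml_instance_gated_cost[OF assms] polymatroid_min polymatroid_card_Int)

lemma sub_ml_instance_hidden_cost:
  assumes "m > 0" "n = k * k * m"
  shows "sub_ml_instance k {..<n} (\<lambda>S. real (hidden_cost k n w d B S)) (loops k n)"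
  unfolding hidden_cost_def
  by (intro sub_ml_instance_gated_cost[OF assms] polymatroid_min polymatroid_add
      polymatroid_card_Int)

section \<open>Agreement of the two costs on balanced sets\<close>

lemma card_inc_edges:
  assumes "finite X"
  shows "card (X \<inter> inc_edges k i) = card (X \<inter> in_edges k B i) + card (X \<inter> out_edges k B i)"
proof -
  have "X \<inter> inc_edges k i = (X \<inter> in_edges k B i) \<union> (X \<inter> out_edges k B i)"
    by (auto simp: inc_edges_def in_edges_def out_edges_def owner_def)
  moreover have "(X \<inter> in_edges k B i) \<inter> (X \<inter> out_edges k B i) = {}"
    by (auto simp: in_edges_def out_edges_def owner_def split: if_splits)
  ultimately show ?thesis
    using assms by (simp add: card_Un_disjoint)
qed

definition balanced :: "nat \<Rightarrow> nat \<Rightarrow> nat \<Rightarrow> nat set \<Rightarrow> nat set \<Rightarrow> bool" where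
  "balanced k n d Q B \<longleftrightarrow> (\<forall>i \<in> {1..k}.
     \<bar>real (card (({..<n} - Q) \<inter> in_edges k B i)) - real (card (({..<n} - Q) \<inter> out_edges k B i))\<bar>
       \<le> real d)"

text \<open>The slack \<open>d\<close> in the inner cap absorbs the imbalance. If one of the two
  counts exceeds \<open>w + d\<close>, the other exceeds \<open>w\<close>, so both costs are capped
  at \<open>2 * w\<close>. Otherwise the inner caps have no effect.\<close>

lemma hidden_cost_eq_public_cost:
  assumes "balanced k n d Q B"
  shows "hidden_cost k n w d B Q = public_cost k n w Q"
  unfolding hidden_cost_def public_cost_def gated_cost_def
proof (intro sum.cong refl)
  fix i assume "i \<in> {1..k}"
  let ?X = "{..<n} - Q"
  let ?a = "card (?X \<inter> in_edges k B i)" and ?b = "card (?X \<inter> out_edges k B i)"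
  have "\<bar>real ?a - real ?b\<bar> \<le> real d"
    using assms \<open>i \<in> {1..k}\<close> unfolding balanced_def by blast
  then have "?a \<le> ?b + d" "?b \<le> ?a + d"
    by linarith+
  then have "min (2 * w) (min (w + d) ?a + min (w + d) ?b) = min (2 * w) (?a + ?b)"
    unfolding min_def by auto
  moreover have "card (?X \<inter> inc_edges k i) = ?a + ?b"
    by (intro card_inc_edges) auto
  ultimately show
    "(if loop k i \<in> Q then min (2 * w) (min (w + d) ?a + min (w + d) ?b) else 0) =
     (if loop k i \<in> Q then min (2 * w) (card (?X \<inter> inc_edges k i)) else 0)"
    by simp
qed

section \<open>Bounds on the costs of solutions\<close>

lemma owner_in_range: "k > 0 \<Longrightarrow> owner k B v \<in> {1..k}"
  by (auto simp: owner_def left_def right_def Suc_le_eq)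

text \<open>Solutions are arbitrary outside \<open>{1..k}\<close>, so there are infinitely many of
  them, but the cost depends only on the restriction to \<open>{1..k}\<close>. Finiteness gives the
  \<open>Min\<close> in \<open>sub_ml_opt\<close> its meaning.\<close>

lemma finite_sub_ml_costs:
  assumes "finite V"
  shows "finite {sub_ml_cost k f S | S. sub_ml_feasible k V T S}"
proof (rule finite_subset)
  show "{sub_ml_cost k f S | S. sub_ml_feasible k V T S}
      \<subseteq> sub_ml_cost k f ` (\<Pi>\<^sub>E i \<in> {1..k}. Pow V)"
  proof safe
    fix S assume "sub_ml_feasible k V T S"
    then have "restrict S {1..k} \<in> (\<Pi>\<^sub>E i \<in> {1..k}. Pow V)"
      by (auto simp: sub_ml_feasible_def)
    moreover have "sub_ml_cost k f S = sub_ml_cost k f (restrict S {1..k})"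
      by (simp add: sub_ml_cost_def)
    ultimately show "sub_ml_cost k f S \<in> sub_ml_cost k f ` (\<Pi>\<^sub>E i \<in> {1..k}. Pow V)"
      by blast
  qed
qed (use assms in \<open>auto intro: finite_PiE\<close>)

lemma sub_ml_opt_hidden_cost:
  assumes "k > 0"
  shows "sub_ml_opt k {..<n} (\<lambda>S. real (hidden_cost k n w d B S)) (loops k n)
    \<le> real k * (real w + real d)"
proof -
  define S where "S i = {v. v < n \<and> owner k B v = i}" for i
  have feas: "sub_ml_feasible k {..<n} (loops k n) S"
    unfolding sub_ml_feasible_def
  proof (intro conjI)
    show "(\<Union>i \<in> {1..k}. S i) = {..<n}"
      using owner_in_range[OF assms, of B] unfolding S_def by blast
  qed (auto simp: disjoint_family_on_def S_def loops_def owner_def)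
  have "hidden_cost k n w d B (S i) \<le> w + d" if i: "i \<in> {1..k}" for i
  proof -
    let ?r = "\<lambda>i X. min (2 * w)
      (min (w + d) (card (X \<inter> in_edges k B i)) + min (w + d) (card (X \<inter> out_edges k B i)))"
    \<comment> \<open>Both ends of a loop carry the same label, so its owner does not depend on
      \<open>B\<close>. Hence only the gate of \<open>i\<close> is open in
      \<open>S i\<close>.\<close>
    have not: "loop k j \<notin> S i" if "j \<in> {1..k}" "j \<noteq> i" for j
      using that left_loop[of j k] right_loop[of j k] by (auto simp: S_def owner_def)
    have "hidden_cost k n w d B (S i) = (\<Sum>j\<in>{1..k}. if loop k j \<in> S i then ?r j ({..<n} - S i) else 0)"
      by (simp add: hidden_cost_def gated_cost_def)
    also have "\<dots> = (\<Sum>j\<in>{i}. if loop k j \<in> S i then ?r j ({..<n} - S i) else 0)"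
      by (rule sum.mono_neutral_right) (use i not in auto)
    also have "\<dots> \<le> ?r i ({..<n} - S i)"
      by simp
    \<comment> \<open>No incoming edge is missed, so only the outgoing part remains, which is capped
      at \<open>w + d\<close>.\<close>
    also have "({..<n} - S i) \<inter> in_edges k B i = {}"
      by (auto simp: S_def in_edges_def)
    finally show ?thesis
      by simp
  qed
  then have "(\<Sum>i = 1..k. hidden_cost k n w d B (S i)) \<le> (\<Sum>i = 1..k. w + d)"
    by (intro sum_mono)
  then have "real (\<Sum>i = 1..k. hidden_cost k n w d B (S i)) \<le> real (k * (w + d))"
    unfolding of_nat_le_iff by simp
  then have "sub_ml_cost k (\<lambda>S. real (hidden_cost k n w d B S)) S \<le> real k * (real w + real d)"
    by (simp add: sub_ml_cost_def)
  moreover have "sub_ml_opt k {..<n} (\<lambda>S. real (hidden_cost k n w d B S)) (loops k n)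
      \<le> sub_ml_cost k (\<lambda>S. real (hidden_cost k n w d B S)) S"
    unfolding sub_ml_opt_def using feas by (intro Min_le finite_sub_ml_costs) auto
  ultimately show ?thesis
    by linarith
qed

lemma card_parallel_edges:
  assumes "i \<in> {1..k}" "j \<in> {1..k}" "n = k * k * m"
  shows "m \<le> card {v. v < n \<and> left k v = i \<and> right k v = j}"
proof -
  \<comment> \<open>The lowest digits fix the two ends, and \<open>x\<close> numbers the
    \<open>m\<close> parallel copies.\<close>
  define e where "e x = (x * k + (j - 1)) * k + (i - 1)" for x
  have ij: "i - 1 < k" "j - 1 < k"
    using assms by auto
  then have ends: "left k (e x) = i" "right k (e x) = j" for x
    using assms(1,2) left_digits[of "i - 1" k] right_digits[of "i - 1" k "j - 1"]
    by (auto simp: e_def)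
  have "inj_on e {..<m}"
    using ij by (auto simp: inj_on_def e_def)
  moreover have "e ` {..<m} \<subseteq> {v. v < n \<and> left k v = i \<and> right k v = j}"
  proof safe
    fix x assume "x < m"
    have "x * k + (j - 1) < Suc x * k"
      using ij by simp
    also have "\<dots> \<le> m * k"
      using \<open>x < m\<close> by (intro mult_right_mono) auto
    finally have "Suc (x * k + (j - 1)) * k \<le> m * k * k"
      by (intro mult_right_mono) auto
    moreover have "e x < Suc (x * k + (j - 1)) * k"
      using ij by (simp add: e_def)
    ultimately show "e x < n"
      using assms(3) by (simp add: ac_simps)
    show "left k (e x) = i" "right k (e x) = j"
      by (rule ends)+
  qed
  ultimately show ?thesis
    using card_inj_on_le[of e "{..<m}"] by simp
qed

lemma public_cost_ge:
  assumes feas: "sub_ml_feasible k {..<n} (loops k n) S"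
    and n: "n = k * k * m" and m: "4 * w \<le> m" "m > 0"
  shows "2 * w * (k - 1) \<le> (\<Sum>i = 1..k. public_cost k n w (S i))"
proof -
  define c where "c i = card (({..<n} - S i) \<inter> inc_edges k i)" for i
  have le: "min (2 * w) (c i) \<le> public_cost k n w (S i)" if i: "i \<in> {1..k}" for i
  proof -
    have "loop k i \<in> loops k n i"
      using i n m loop_less[of i k m] left_loop[of i k] right_loop[of i k]
      by (auto simp: loops_def)
    then have "loop k i \<in> S i"
      using feas i by (auto simp: sub_ml_feasible_def)
    then have "min (2 * w) (c i) =
        (if loop k i \<in> S i then min (2 * w) (card (({..<n} - S i) \<inter> inc_edges k i)) else 0)"
      by (simp add: c_def)
    also have "\<dots> \<le> public_cost k n w (S i)"
      unfolding public_cost_def gated_cost_def by (rule member_le_sum) (use i in auto)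
    finally show ?thesis .
  qed
  have two: "4 * w \<le> c i + c j" if ij: "i \<in> {1..k}" "j \<in> {1..k}" "i \<noteq> j" for i j
  proof -
    let ?E = "{v. v < n \<and> left k v = i \<and> right k v = j}"
    have "S i \<inter> S j = {}"
      using feas ij by (auto simp: sub_ml_feasible_def disjoint_family_on_def)
    \<comment> \<open>Each edge between \<open>i\<close> and \<open>j\<close> is missed by at least
      one of the two disjoint sets.\<close>
    then have "?E \<subseteq> (({..<n} - S i) \<inter> inc_edges k i) \<union> (({..<n} - S j) \<inter> inc_edges k j)"
      using ij by (auto simp: inc_edges_def)
    then have "card ?E \<le> card ((({..<n} - S i) \<inter> inc_edges k i) \<union> (({..<n} - S j) \<inter> inc_edges k j))"
      by (intro card_mono) auto
    also have "\<dots> \<le> c i + c j"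
      unfolding c_def by (rule card_Un_le)
    finally show ?thesis
      using card_parallel_edges[OF ij(1,2) n] m by linarith
  qed
  have "\<exists>i0. \<forall>i \<in> {1..k} - {i0}. 2 * w \<le> c i"
  proof (cases "\<exists>i0 \<in> {1..k}. c i0 < 2 * w")
    case True
    then obtain i0 where "i0 \<in> {1..k}" "c i0 < 2 * w"
      by blast
    then have "2 * w \<le> c i" if "i \<in> {1..k} - {i0}" for i
      using two[of i i0] that by auto
    then show ?thesis
      by blast
  next
    case False
    then show ?thesis
      by (metis Diff_iff not_le)
  qed
  then obtain i0 where i0: "\<And>i. i \<in> {1..k} - {i0} \<Longrightarrow> 2 * w \<le> c i"
    by blast
  \<comment> \<open>An inequality, as \<open>i0\<close> may lie outside \<open>{1..k}\<close> when
    no label is exceptional.\<close>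
  have "2 * w * (k - 1) \<le> 2 * w * card ({1..k} - {i0})"
    by (intro mult_left_mono) (auto simp: card_Diff_singleton_if)
  also have "\<dots> = (\<Sum>i \<in> {1..k} - {i0}. 2 * w)"
    by simp
  also have "\<dots> \<le> (\<Sum>i \<in> {1..k} - {i0}. public_cost k n w (S i))"
    using le i0 by (intro sum_mono) (metis Diff_iff min.absorb1)
  also have "\<dots> \<le> (\<Sum>i = 1..k. public_cost k n w (S i))"
    by (rule sum_mono2) auto
  finally show ?thesis .
qed


section \<open>Few orientations are distinguished by a query\<close>

text \<open>Adding \<open>exp x \<le> 1 + x + x\<^sup>2\<close> and its counterpart for
  \<open>- x\<close> cancels the linear terms, and
  \<open>1 + x\<^sup>2 \<le> exp (x\<^sup>2)\<close> finishes.\<close>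

lemma exp_add_exp_minus_le:
  fixes y :: real
  assumes "\<bar>y\<bar> \<le> 1"
  shows "exp y + exp (- y) \<le> 2 * exp (y\<^sup>2)"
proof -
  have *: "exp x + exp (- x) \<le> 2 * exp (x\<^sup>2)" if x: "0 \<le> x" "x \<le> 1" for x :: real
  proof -
    have "exp (- x) \<le> 1 - x + x\<^sup>2"
    proof -
      \<comment> \<open>The product equals 1 + x^3.\<close>
      have "1 \<le> (1 - x + x\<^sup>2) * (1 + x)"
        using x by (simp add: algebra_simps power2_eq_square)
      also have "\<dots> \<le> (1 - x + x\<^sup>2) * exp x"
        using x by (intro mult_left_mono) auto
      finally show ?thesis
        by (simp add: exp_minus field_simps)
    qed
    moreover have "exp x \<le> 1 + x + x\<^sup>2"
      using x by (intro exp_bound)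
    moreover have "1 + x\<^sup>2 \<le> exp (x\<^sup>2)"
      by (rule exp_ge_add_one_self)
    ultimately show ?thesis
      by linarith
  qed
  show ?thesis
    using *[of y] *[of "- y"] assms by (cases "y \<ge> 0") auto
qed

text \<open>An unnormalised moment generating function: for uniformly random \<open>B\<close>, the
  difference of the cardinalities is a sum of independent signs over \<open>X\<close>, so its
  exponential moment factorises over the elements. The set \<open>P\<close> fixes which choice
  counts as positive.\<close>

lemma sum_Pow_exp_le:
  fixes l :: real
  assumes V: "finite V" "X \<subseteq> V" and l: "\<bar>l\<bar> \<le> 1"
  shows "(\<Sum>B \<in> Pow V. exp (l * (real (card {v \<in> X. v \<in> B \<longleftrightarrow> v \<in> P})
      - real (card {v \<in> X. \<not> (v \<in> B \<longleftrightarrow> v \<in> P)})))) \<le> 2 ^ card V * exp (l\<^sup>2 * real (card V))"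
proof -
  \<comment> \<open>The exponent gains \<open>s v\<close> if \<open>v \<in> B\<close> and
    \<open>- s v\<close> otherwise; the value 0 outside \<open>X\<close> lets the product range over
    all of \<open>V\<close>.\<close>
  define s where "s v = (if v \<in> X then if v \<in> P then l else - l else 0)" for v
  have "exp (l * (real (card {v \<in> X. v \<in> B \<longleftrightarrow> v \<in> P}) - real (card {v \<in> X. \<not> (v \<in> B \<longleftrightarrow> v \<in> P)})))
      = (\<Prod>v\<in>B. exp (s v)) * (\<Prod>v\<in>V - B. exp (- s v))" if B: "B \<subseteq> V" for B
  proof -
    have "finite X"
      using V finite_subset by blast
    have "(\<Sum>v\<in>V. if v \<in> B then s v else - s v)
        = (\<Sum>v\<in>X. (if v \<in> B \<longleftrightarrow> v \<in> P then l else 0) - (if \<not> (v \<in> B \<longleftrightarrow> v \<in> P) then l else 0))"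
      using V by (intro sum.mono_neutral_cong_right) (auto simp: s_def)
    also have "\<dots> = l * (real (card {v \<in> X. v \<in> B \<longleftrightarrow> v \<in> P})
        - real (card {v \<in> X. \<not> (v \<in> B \<longleftrightarrow> v \<in> P)}))"
      using \<open>finite X\<close>
      by (simp only: sum_subtractf sum.inter_filter[symmetric] sum_constant)
        (simp add: algebra_simps)
    finally have eq: "l * (real (card {v \<in> X. v \<in> B \<longleftrightarrow> v \<in> P})
        - real (card {v \<in> X. \<not> (v \<in> B \<longleftrightarrow> v \<in> P)})) = (\<Sum>v\<in>V. if v \<in> B then s v else - s v)"
      by simp
    have "(\<Sum>v\<in>V. if v \<in> B then s v else - s v)
        = (\<Sum>v\<in>B. if v \<in> B then s v else - s v) + (\<Sum>v\<in>V - B. if v \<in> B then s v else - s v)"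
      using sum.subset_diff[OF B V(1), of "\<lambda>v. if v \<in> B then s v else - s v"] by simp
    also have "\<dots> = (\<Sum>v\<in>B. s v) + (\<Sum>v\<in>V - B. - s v)"
      by (intro arg_cong2[where f = "(+)"] sum.cong) auto
    finally show ?thesis
      unfolding eq using V B finite_subset[OF B V(1)] by (simp add: exp_add exp_sum)
  qed
  then have "(\<Sum>B \<in> Pow V. exp (l * (real (card {v \<in> X. v \<in> B \<longleftrightarrow> v \<in> P})
      - real (card {v \<in> X. \<not> (v \<in> B \<longleftrightarrow> v \<in> P)}))))
      = (\<Sum>B \<in> Pow V. (\<Prod>v\<in>B. exp (s v)) * (\<Prod>v\<in>V - B. exp (- s v)))"
    by (intro sum.cong) auto
  also have "\<dots> = (\<Prod>v\<in>V. exp (s v) + exp (- s v))"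
    using V by (simp add: prod_add)
  also have "\<dots> \<le> (\<Prod>v\<in>V. 2 * exp (l\<^sup>2))"
  proof (intro prod_mono conjI)
    fix v
    have "exp (s v) + exp (- s v) \<le> 2 * exp ((s v)\<^sup>2)"
      using l by (intro exp_add_exp_minus_le) (auto simp: s_def)
    also have "\<dots> \<le> 2 * exp (l\<^sup>2)"
      by (auto simp: s_def)
    finally show "exp (s v) + exp (- s v) \<le> 2 * exp (l\<^sup>2)" .
  qed (auto intro: add_nonneg_nonneg)
  also have "\<dots> = 2 ^ card V * exp (l\<^sup>2 * real (card V))"
    by (simp add: power_mult_distrib exp_of_nat2_mult)
  finally show ?thesis .
qed

text \<open>Chernoff's method: Markov's inequality for the exponential moment, written with
  cardinalities instead of probabilities.\<close>

lemma card_unbalanced_at: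
  fixes d :: nat
  assumes V: "finite V" "X \<subseteq> V" "V \<noteq> {}" and d: "d \<le> 2 * card V"
  shows "real (card {B \<in> Pow V. real d < \<bar>real (card {v \<in> X. v \<in> B \<longleftrightarrow> v \<in> P})
      - real (card {v \<in> X. \<not> (v \<in> B \<longleftrightarrow> v \<in> P)})\<bar>})
    \<le> 2 * 2 ^ card V * exp (- (real d)\<^sup>2 / (4 * real (card V)))"
proof -
  define y where "y B = real (card {v \<in> X. v \<in> B \<longleftrightarrow> v \<in> P})
      - real (card {v \<in> X. \<not> (v \<in> B \<longleftrightarrow> v \<in> P)})" for B
  define N where "N = real (card V)"
  \<comment> \<open>This value minimises \<open>l\<^sup>2 * N - l * real d\<close>; the bound
    \<open>d \<le> 2 * card V\<close> makes it at most 1.\<close>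
  define l where "l = real d / (2 * N)"
  have N: "N > 0"
    using V by (simp add: N_def card_gt_0_iff)
  have l: "0 \<le> l" "l \<le> 1"
    using N d unfolding l_def N_def by (auto simp: field_simps)
  have "real (card {B \<in> Pow V. real d < \<bar>y B\<bar>}) * exp (l * real d)
      = (\<Sum>B \<in> {B \<in> Pow V. real d < \<bar>y B\<bar>}. exp (l * real d))"
    by simp
  \<comment> \<open>Adding the exponentials of both signs treats the two tails at once.\<close>
  also have "\<dots> \<le> (\<Sum>B \<in> {B \<in> Pow V. real d < \<bar>y B\<bar>}. exp (l * y B) + exp (- l * y B))"
  proof (intro sum_mono)
    fix B assume "B \<in> {B \<in> Pow V. real d < \<bar>y B\<bar>}"
    then have "l * real d \<le> l * \<bar>y B\<bar>"
      using l by (intro mult_left_mono) auto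
    then have "exp (l * real d) \<le> exp (l * \<bar>y B\<bar>)"
      by simp
    also have "\<dots> \<le> exp (l * y B) + exp (- l * y B)"
      by (cases "y B \<ge> 0") (auto simp: add_nonneg_nonneg)
    finally show "exp (l * real d) \<le> exp (l * y B) + exp (- l * y B)" .
  qed
  also have "\<dots> \<le> (\<Sum>B \<in> Pow V. exp (l * y B) + exp (- l * y B))"
    using V by (intro sum_mono2) (auto intro: add_nonneg_nonneg)
  also have "\<dots> \<le> 2 ^ card V * exp (l\<^sup>2 * N) + 2 ^ card V * exp ((- l)\<^sup>2 * N)"
    unfolding sum.distrib y_def N_def using V l by (intro add_mono sum_Pow_exp_le) auto
  finally have "real (card {B \<in> Pow V. real d < \<bar>y B\<bar>}) * exp (l * real d)
      \<le> 2 * 2 ^ card V * exp (l\<^sup>2 * N)"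
    by simp
  then have "real (card {B \<in> Pow V. real d < \<bar>y B\<bar>}) \<le> 2 * 2 ^ card V * exp (l\<^sup>2 * N - l * real d)"
    by (simp add: exp_diff field_simps)
  also have "l\<^sup>2 * N - l * real d = - (real d)\<^sup>2 / (4 * N)"
    using N by (simp add: l_def field_simps power2_eq_square)
  finally show ?thesis
    unfolding y_def N_def .
qed

lemma card_unbalanced:
  assumes "n > 0" "d \<le> 2 * n"
  shows "real (card {B \<in> Pow {..<n}. \<not> balanced k n d Q B})
    \<le> real k * (2 * 2 ^ n * exp (- (real d)\<^sup>2 / (4 * real n)))"
proof -
  define X where "X i = ({..<n} - Q) \<inter> inc_edges k i" for i
  \<comment> \<open>An edge at \<open>i\<close> points to \<open>i\<close> iff membership in
    \<open>B\<close> agrees with having \<open>i\<close> as its left end.\<close>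
  define P where "P i = {v. left k v = i}" for i
  define bad where "bad i = {B \<in> Pow {..<n}. real d < \<bar>real (card {v \<in> X i. v \<in> B \<longleftrightarrow> v \<in> P i})
      - real (card {v \<in> X i. \<not> (v \<in> B \<longleftrightarrow> v \<in> P i)})\<bar>}" for i
  have "({..<n} - Q) \<inter> in_edges k B i = {v \<in> X i. v \<in> B \<longleftrightarrow> v \<in> P i}"
    "({..<n} - Q) \<inter> out_edges k B i = {v \<in> X i. \<not> (v \<in> B \<longleftrightarrow> v \<in> P i)}" for B i
    by (auto simp: X_def P_def in_edges_def out_edges_def inc_edges_def owner_def split: if_splits)
  then have "{B \<in> Pow {..<n}. \<not> balanced k n d Q B} = (\<Union>i \<in> {1..k}. bad i)"
    unfolding balanced_def bad_def by (auto simp: not_le)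
  then have "card {B \<in> Pow {..<n}. \<not> balanced k n d Q B} \<le> (\<Sum>i \<in> {1..k}. card (bad i))"
    by (simp add: card_UN_le)
  then have "real (card {B \<in> Pow {..<n}. \<not> balanced k n d Q B}) \<le> (\<Sum>i \<in> {1..k}. real (card (bad i)))"
    by (simp flip: of_nat_sum)
  also have "\<dots> \<le> (\<Sum>i \<in> {1..k}. 2 * 2 ^ n * exp (- (real d)\<^sup>2 / (4 * real n)))"
  proof (intro sum_mono)
    fix i
    show "real (card (bad i)) \<le> 2 * 2 ^ n * exp (- (real d)\<^sup>2 / (4 * real n))"
      using card_unbalanced_at[of "{..<n}" "X i" d "P i"] assms
      by (auto simp: bad_def X_def)
  qed
  finally show ?thesis
    by simp
qed

text \<open>A union bound over \<open>\<Q>\<close>: the bad orientations of all its members together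
  number fewer than \<open>2 ^ n\<close>.\<close>

lemma exists_balanced_orientation:
  assumes "n > 0" "d \<le> 2 * n" "finite \<Q>"
    and small: "2 * real k * real (card \<Q>) < exp ((real d)\<^sup>2 / (4 * real n))"
  shows "\<exists>B. \<forall>Q \<in> \<Q>. balanced k n d Q B"
proof (rule ccontr)
  assume "\<nexists>B. \<forall>Q \<in> \<Q>. balanced k n d Q B"
  define bad where "bad Q = {B \<in> Pow {..<n}. \<not> balanced k n d Q B}" for Q
  have "Pow {..<n} \<subseteq> (\<Union>Q \<in> \<Q>. bad Q)"
    using \<open>\<nexists>B. \<forall>Q \<in> \<Q>. balanced k n d Q B\<close> by (auto simp: bad_def)
  then have "card (Pow {..<n}) \<le> card (\<Union>Q \<in> \<Q>. bad Q)"
    using \<open>finite \<Q>\<close> by (intro card_mono) (auto simp: bad_def)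
  also have "\<dots> \<le> (\<Sum>Q \<in> \<Q>. card (bad Q))"
    using \<open>finite \<Q>\<close> by (rule card_UN_le)
  finally have "real (2 ^ n) \<le> real (\<Sum>Q \<in> \<Q>. card (bad Q))"
    unfolding of_nat_le_iff by (simp add: card_Pow)
  then have "2 ^ n \<le> (\<Sum>Q \<in> \<Q>. real (card (bad Q)))"
    by simp
  also have "\<dots> \<le> (\<Sum>Q \<in> \<Q>. real k * (2 * 2 ^ n * exp (- (real d)\<^sup>2 / (4 * real n))))"
    unfolding bad_def using assms by (intro sum_mono card_unbalanced)
  also have "\<dots> = 2 ^ n * (2 * real k * real (card \<Q>) / exp ((real d)\<^sup>2 / (4 * real n)))"
    by (simp add: exp_minus field_simps)
  also have "\<dots> < 2 ^ n * 1"
    using small by (intro mult_strict_left_mono) (auto simp: divide_less_eq)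
  finally show False
    by simp
qed


section \<open>Runs of oracle machines\<close>

text \<open>The oracles are compared along the run with \<open>orc\<close> only; by induction the
  other run visits the same configurations. Asking for agreement on the oracle tape at every step
  avoids singling out query states.\<close>

lemma funpow_step_cong:
  assumes "\<And>s. s < t \<Longrightarrow>
    (case (step M orc ^^ s) c of (q, ts) \<Rightarrow> orc (read_word (ts ! 1)) = orc' (read_word (ts ! 1)))"
  shows "(step M orc' ^^ t) c = (step M orc ^^ t) c"
  using assms
proof (induction t)
  case (Suc t)
  obtain q ts where qts: "(step M orc ^^ t) c = (q, ts)"
    by fastforce
  then have "orc (read_word (ts ! 1)) = orc' (read_word (ts ! 1))"
    using Suc.prems[of t] by simp
  moreover have "(step M orc' ^^ t) c = (q, ts)"
    using Suc qts by simp
  ultimately show ?case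
    using qts by simp
qed simp

lemma funpow_step_halted: "(step M orc ^^ t) (halt_state, ts) = (halt_state, ts)"
  by (induction t) auto

lemma computes_within_mono:
  assumes "computes_within M orc w t out" "t \<le> t'"
  shows "computes_within M orc w t' out"
proof -
  obtain ts where ts: "(step M orc ^^ t) (init_config M w) = (halt_state, ts)"
    "read_word (ts ! 2) = out"
    using assms(1) by (auto simp: computes_within_def)
  have "(step M orc ^^ t') (init_config M w)
      = (step M orc ^^ (t' - t)) ((step M orc ^^ t) (init_config M w))"
    using assms(2) by (metis comp_apply funpow_add le_add_diff_inverse2)
  then show ?thesis
    using ts by (simp add: computes_within_def funpow_step_halted)
qed

text \<open>Halted runs stay halted, so both outputs can be read off at the later of the two
  times.\<close>

lemma computes_within_unique:
  assumes "computes_within M orc w t out" "computes_within M orc w t' out'"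
  shows "out = out'"
proof -
  have "computes_within M orc w (max t t') out" "computes_within M orc w (max t t') out'"
    using assms by (auto intro: computes_within_mono)
  then show ?thesis
    by (auto simp: computes_within_def split: prod.splits)
qed

section \<open>Injectivity and length of encodings\<close>

lemma enc_family_inject:
  assumes "enc_family k n S = enc_family k n S'" "i \<in> {1..k}" "v < n"
  shows "v \<in> S i \<longleftrightarrow> v \<in> S' i"
proof -
  let ?row = "\<lambda>S i. map (\<lambda>v. v \<in> S i) [0..<n]"
  have "map (?row S) [1..<Suc k] = map (?row S') [1..<Suc k]"
    using assms(1) unfolding enc_family_def
    by (rule concat_injective) (auto simp: zip_map_map zip_same)
  then have "?row S i = ?row S' i"
    using assms(2) unfolding map_eq_conv[of "?row S"] by (auto simp del: upt_Suc map_eq_conv)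
  then show ?thesis
    using assms(3) by (auto simp: map_eq_conv)
qed

text \<open>A linear bound is enough, because the ground set size and the cost values will grow only
  linearly with the parameter \<open>z\<close> of the construction.\<close>

lemma length_nat_bits_le: "length (nat_bits a) \<le> a"
proof (induction a rule: nat_bits.induct)
  case (1 a)
  then show ?case
    by (subst nat_bits.simps) auto
qed

lemma length_enc_nat_le: "length (enc_nat a) \<le> 2 * a + 1"
proof -
  have "length (concat (map (\<lambda>b. [True, b]) w)) = 2 * length w" for w
    by (induction w) auto
  then show ?thesis
    using length_nat_bits_le[of a] by (simp add: enc_nat_def enc_word_def)
qed

lemma length_enc_instance_le: "length (enc_instance k n T) \<le> (2 + k) * n + 1"
proof -
  have "length (enc_family k n T) = k * n"
    by (simp add: enc_family_def length_concat comp_def sum_list_triv)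
  then show ?thesis
    using length_enc_nat_le[of n] by (simp add: enc_instance_def)
qed

lemma length_enc_rat_of_nat_le: "length (enc_rat (of_nat a)) \<le> 2 * a + 4"
proof -
  have "quotient_of (of_nat a) = (int a, 1)"
    using quotient_of_int[of "int a"] by (simp add: Rat.of_int_def)
  then show ?thesis
    using length_enc_nat_le[of a] length_enc_nat_le[of 1] by (simp add: enc_rat_def)
qed

lemma value_size_le:
  assumes "\<And>X. X \<subseteq> {..<n} \<Longrightarrow> h X \<le> b"
  shows "value_size n (\<lambda>X. of_nat (h X)) \<le> 2 * b + 4"
  unfolding value_size_def
proof (intro Max.boundedI)
  fix l assume "l \<in> (\<lambda>X. length (enc_rat (of_nat (h X)))) ` Pow {..<n}"
  then obtain X where "X \<subseteq> {..<n}" "l = length (enc_rat (of_nat (h X)))"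
    by blast
  then show "l \<le> 2 * b + 4"
    using assms[of X] length_enc_rat_of_nat_le[of "h X"] by linarith
qed auto

lemma public_cost_le: "public_cost k n w S \<le> 2 * w * k"
proof -
  have "public_cost k n w S \<le> (\<Sum>i = 1..k. 2 * w)"
    unfolding public_cost_def gated_cost_def by (intro sum_mono) auto
  then show ?thesis
    by (simp add: ac_simps)
qed

section \<open>Polynomials against the exponential function\<close>

lemma poly_nat_mono:
  fixes p :: "nat poly"
  assumes "x \<le> y"
  shows "poly p x \<le> poly p y"
  unfolding poly_altdef using assms by (intro sum_mono mult_left_mono power_mono) auto

lemma exists_poly_less_exp:
  fixes p :: "nat poly"
  shows "\<exists>z \<ge> 1. c * (real (poly p (a * z + b)) + e) < exp (real z)"
proof -
  define q where "q = smult c (pcompose (map_poly real p) [:real b, real a:] + [:e:])"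
  have poly_q: "poly q (real z) = c * (real (poly p (a * z + b)) + e)" for z
  proof -
    have "poly (map_poly real p) (real x) = real (poly p x)" for x
      by (induction p) (auto simp: map_poly_pCons)
    from this[of "a * z + b"] show ?thesis
      by (simp add: q_def poly_pcompose ac_simps)
  qed
  have "((\<lambda>x. \<Sum>i\<le>degree q. coeff q i * (x ^ i / exp x)) \<longlongrightarrow> (\<Sum>i\<le>degree q. coeff q i * 0)) at_top"
    by (intro tendsto_intros tendsto_power_div_exp_0)
  then have "((\<lambda>x. poly q x / exp x) \<longlongrightarrow> 0) at_top"
    by (simp add: poly_altdef sum_divide_distrib)
  then have "((\<lambda>z. poly q (real z) / exp (real z)) \<longlongrightarrow> 0) sequentially"
    by (rule filterlim_compose[OF _ filterlim_real_sequentially])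
  then have "eventually (\<lambda>z. poly q (real z) / exp (real z) < 1) sequentially"
    by (rule order_tendstoD) simp
  then have "eventually (\<lambda>z. z \<ge> 1 \<and> poly q (real z) / exp (real z) < 1) sequentially"
    using eventually_ge_at_top by (rule eventually_conj[rotated])
  then obtain z where "z \<ge> 1" "poly q (real z) / exp (real z) < 1"
    by (auto dest: eventually_happens)
  then have "poly q (real z) < exp (real z)"
    by (simp add: divide_less_eq)
  then show ?thesis
    unfolding poly_q using \<open>z \<ge> 1\<close> by blast
qed

section \<open>The adversary argument\<close>

theorem corollary14:
  fixes k :: nat and \<epsilon> :: real
  assumes "unique_games_conjecture"
    and "class_P \<noteq> class_NP"
    and "k \<ge> 2"
    and "\<epsilon> > 0"
  shows "\<nexists>M. wf_otm M \<and> sub_ml_approximation k (2 - 2 / real k - \<epsilon>) M"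
proof
  assume "\<exists>M. wf_otm M \<and> sub_ml_approximation k (2 - 2 / real k - \<epsilon>) M"
  then obtain M p where M: "\<And>n g T. sub_ml_instance k {..<n} (\<lambda>X. real_of_rat (g X)) T \<Longrightarrow>
      \<exists>S. computes_within M (value_oracle n g) (enc_instance k n T)
        (poly p (length (enc_instance k n T) + value_size n g)) (enc_family k n S) \<and>
        sub_ml_feasible k {..<n} T S \<and>
        sub_ml_cost k (\<lambda>X. real_of_rat (g X)) S
          \<le> (2 - 2 / real k - \<epsilon>) * sub_ml_opt k {..<n} (\<lambda>X. real_of_rat (g X)) T"
    unfolding sub_ml_approximation_def by meson
  \<comment> \<open>\<open>L\<close> will be the ratio \<open>w / d\<close>; this bound makes the
    loss caused by \<open>d\<close> smaller than the gain from \<open>\<epsilon>\<close>.\<close>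
  obtain L :: nat where L: "2 / \<epsilon> < real L"
    using reals_Archimedean2 by blast
  then have "L > 0"
    using \<open>\<epsilon> > 0\<close> by (cases L) (auto simp: field_simps)
  \<comment> \<open>Chosen so that \<open>a * z + 5\<close> bounds the input length plus the value
    size of the public cost.\<close>
  define a where "a = ((2 + k) * (k * k * 4) + 4 * k) * (L * (16 * k * k * L))"
  obtain z where z: "z \<ge> 1" "2 * real k * (real (poly p (a * z + 5)) + real k) < exp (real z)"
    using exists_poly_less_exp by blast
  \<comment> \<open>With \<open>n = 4 * k * k * L * d\<close>, this factor makes the Chernoff
    exponent \<open>d\<^sup>2 / (4 * n)\<close> exactly \<open>z\<close>.\<close>
  define d where "d = 16 * k * k * L * z"
  define w where "w = L * d"
  \<comment> \<open>There are \<open>4 * w\<close> parallel edges for each pair of ends, as the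
    lower bound on the public cost requires.\<close>
  define n where "n = k * k * (4 * w)"
  have pos: "d > 0" "w > 0" "n > 0" "k > 0"
    using \<open>k \<ge> 2\<close> \<open>L > 0\<close> z by (auto simp: d_def w_def n_def)
  have d_le: "d \<le> 2 * n"
    using pos \<open>L > 0\<close> by (simp add: n_def w_def)
  have exponent: "(real d)\<^sup>2 / (4 * real n) = real z"
    using pos \<open>L > 0\<close> by (simp add: n_def w_def d_def power2_eq_square field_simps)
  define T where "T = loops k n"
  define x where "x = enc_instance k n T"
  define pub where "pub X = rat_of_nat (public_cost k n w X)" for X
  have "sub_ml_instance k {..<n} (\<lambda>X. real_of_rat (pub X)) T"
    using sub_ml_instance_public_cost[OF _ n_def] pos by (simp add: pub_def T_def)
  then obtain S where
    run: "computes_within M (value_oracle n pub) x (poly p (length x + value_size n pub)) (enc_family k n S)"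
    and feas: "sub_ml_feasible k {..<n} T S"
    using M unfolding x_def by blast
  define t where "t = poly p (length x + value_size n pub)"
  have "length x + value_size n pub \<le> ((2 + k) * n + 1) + (2 * (2 * w * k) + 4)"
    unfolding x_def pub_def by (intro add_mono length_enc_instance_le value_size_le public_cost_le)
  also have "\<dots> = a * z + 5"
    by (simp add: n_def w_def d_def a_def algebra_simps)
  finally have t: "t \<le> poly p (a * z + 5)"
    unfolding t_def by (rule poly_nat_mono)
  define query where "query s = read_word (snd ((step M (value_oracle n pub) ^^ s) (init_config M x)) ! 1)" for s
  \<comment> \<open>The output sets are included, so that the returned solution also has equal
    public and hidden cost.\<close>
  define \<Q> where "\<Q> = (\<lambda>s. {v. v < n \<and> query s ! v}) ` {..<t} \<union> S ` {1..k}"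
  have "card \<Q> \<le> card {..<t} + card {1..k}"
    unfolding \<Q>_def by (intro order_trans[OF card_Un_le] add_mono card_image_le) auto
  then have "real (card \<Q>) \<le> real (poly p (a * z + 5)) + real k"
    using t by simp
  then have "2 * real k * real (card \<Q>) \<le> 2 * real k * (real (poly p (a * z + 5)) + real k)"
    by (intro mult_left_mono) auto
  then have "2 * real k * real (card \<Q>) < exp ((real d)\<^sup>2 / (4 * real n))"
    using z exponent by simp
  moreover have "finite \<Q>"
    by (simp add: \<Q>_def)
  ultimately obtain B where B: "\<forall>Q \<in> \<Q>. balanced k n d Q B"
    using exists_balanced_orientation[OF pos(3) d_le, of \<Q> k] by auto
  define hid where "hid X = rat_of_nat (hidden_cost k n w d B X)" for X
  have agree: "hidden_cost k n w d B Q = public_cost k n w Q" if "Q \<in> \<Q>" for Q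
    using that B by (intro hidden_cost_eq_public_cost) auto
  have "sub_ml_instance k {..<n} (\<lambda>X. real_of_rat (hid X)) T"
    using sub_ml_instance_hidden_cost[OF _ n_def] pos by (simp add: hid_def T_def)
  then obtain S' t' where
    run': "computes_within M (value_oracle n hid) x t' (enc_family k n S')"
    and feas': "sub_ml_feasible k {..<n} T S'"
    and cost': "sub_ml_cost k (\<lambda>X. real_of_rat (hid X)) S'
          \<le> (2 - 2 / real k - \<epsilon>) * sub_ml_opt k {..<n} (\<lambda>X. real_of_rat (hid X)) T"
    using M unfolding x_def by blast
  \<comment> \<open>Words of length other than \<open>n\<close> get the empty answer from both
    oracles.\<close>
  have "value_oracle n pub (query s) = value_oracle n hid (query s)" if "s < t" for s
    using agree[of "{v. v < n \<and> query s ! v}"] that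
    by (auto simp: value_oracle_def pub_def hid_def \<Q>_def)
  then have "(step M (value_oracle n hid) ^^ t) (init_config M x)
      = (step M (value_oracle n pub) ^^ t) (init_config M x)"
    by (intro funpow_step_cong) (simp add: query_def case_prod_unfold)
  then have "computes_within M (value_oracle n hid) x t (enc_family k n S)"
    using run by (simp add: computes_within_def t_def)
  \<comment> \<open>The time bounds \<open>t\<close> and \<open>t'\<close> may differ, since the two
    functions may have different value sizes; the outputs still agree.\<close>
  then have "enc_family k n S = enc_family k n S'"
    using run' by (rule computes_within_unique)
  then have "v \<in> S i \<longleftrightarrow> v \<in> S' i" if "i \<in> {1..k}" "v < n" for i v
    using that by (rule enc_family_inject)
  moreover have "S i \<subseteq> {..<n}" "S' i \<subseteq> {..<n}" if "i \<in> {1..k}" for i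
    using feas feas' that by (auto simp: sub_ml_feasible_def)
  ultimately have "S' i = S i" if "i \<in> {1..k}" for i
    using that by blast
  then have "sub_ml_cost k (\<lambda>X. real_of_rat (hid X)) S' = real (\<Sum>i = 1..k. public_cost k n w (S i))"
    unfolding sub_ml_cost_def of_nat_sum
    by (intro sum.cong) (auto simp: hid_def agree \<Q>_def)
  moreover have "2 * w * (k - 1) \<le> (\<Sum>i = 1..k. public_cost k n w (S i))"
    using feas pos unfolding T_def by (intro public_cost_ge[OF _ n_def]) auto
  then have "real (2 * w * (k - 1)) \<le> real (\<Sum>i = 1..k. public_cost k n w (S i))"
    by (simp only: of_nat_le_iff)
  ultimately have low: "2 * real w * (real k - 1)
      \<le> (2 - 2 / real k - \<epsilon>) * sub_ml_opt k {..<n} (\<lambda>X. real_of_rat (hid X)) T"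
    using cost' pos by (simp add: of_nat_diff)
  have opt: "sub_ml_opt k {..<n} (\<lambda>X. real_of_rat (hid X)) T \<le> real k * (real w + real d)"
    using sub_ml_opt_hidden_cost[OF pos(4)] by (simp add: hid_def T_def)
  have upper: "(2 - 2 / real k - \<epsilon>) * (real k * (real w + real d)) < 2 * real w * (real k - 1)"
  proof -
    have "2 < \<epsilon> * real L"
      using L \<open>\<epsilon> > 0\<close> by (simp add: field_simps)
    then have "2 * real k < \<epsilon> * real L * real k"
      using pos by (intro mult_strict_right_mono) auto
    moreover have "0 < \<epsilon> * real k"
      using pos \<open>\<epsilon> > 0\<close> by simp
    moreover have "0 < a + b - 2 * (c - 1)" if "2 * c < a" "0 < b" for a b c :: real
      using that by simp
    ultimately have "0 < \<epsilon> * real L * real k + \<epsilon> * real k - 2 * (real k - 1)"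
      by blast
    then have "0 < real d * (\<epsilon> * real L * real k + \<epsilon> * real k - 2 * (real k - 1))"
      using pos by (intro mult_pos_pos) simp_all
    moreover have "(2 - 2 / real k - \<epsilon>) * (real k * (real w + real d))
        = ((2 - 2 / real k - \<epsilon>) * real k) * (real w + real d)"
      by simp
    moreover have "(2 - 2 / real k - \<epsilon>) * real k = 2 * (real k - 1) - \<epsilon> * real k"
      using pos by (simp add: left_diff_distrib)
    ultimately show ?thesis
      by (simp add: w_def algebra_simps)
  qed
  \<comment> \<open>The upper bound on the optimum may be multiplied by the ratio only if the ratio
    is non-negative. Its positivity follows from the positive lower bound on the cost and the
    non-negative optimum.\<close>
  have "0 < 2 * real w * (real k - 1)"
    using pos \<open>k \<ge> 2\<close> by simp
  then have "0 < (2 - 2 / real k - \<epsilon>) * sub_ml_opt k {..<n} (\<lambda>X. real_of_rat (hid X)) T"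
    using low by linarith
  moreover have "0 \<le> sub_ml_opt k {..<n} (\<lambda>X. real_of_rat (hid X)) T"
  proof -
    let ?C = "{sub_ml_cost k (\<lambda>X. real_of_rat (hid X)) S |S. sub_ml_feasible k {..<n} T S}"
    have "Min ?C \<in> ?C"
      using feas by (intro Min_in finite_sub_ml_costs) auto
    then show ?thesis
      unfolding sub_ml_opt_def by (auto simp: sub_ml_cost_def hid_def intro!: sum_nonneg)
  qed
  ultimately have "0 < 2 - 2 / real k - \<epsilon>"
    by (simp add: zero_less_mult_iff)
  then have "(2 - 2 / real k - \<epsilon>) * sub_ml_opt k {..<n} (\<lambda>X. real_of_rat (hid X)) T
      \<le> (2 - 2 / real k - \<epsilon>) * (real k * (real w + real d))"
    using opt by (intro mult_left_mono) auto
  then show False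
    using low upper by linarith
qed

end
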